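(* Let $X_1, \dotsc, X_p, y$ be real-valued random variables (on a common probability space) with mean zero and unit variance. Suppose $\beta = (\beta_1,\dotsc,\beta_p)^{\mathsf T} \in \mathbb{R}^p$ is a minimizer of the least squares problem, i.e. $$\beta \in \arg\min_{\alpha = (\alpha_1,\dotsc,\alpha_p)^{\mathsf T} \in \mathbb{R}^p} \mathbb{E}\left[\left(\alpha_1 X_1 + \cdots + \alpha_p X_p - y\right)^2\right].$$ Then the squared $\ell_2$ norm of $\beta$ satisfies $$\|\beta\|^2 \ \leq \ \frac{1}{\lambda_{\min}},$$ where $\lambda_{\min}$ is the minimum eigenvalue of the second-moment matrix $\mathbb{E}(XX^{\mathsf T})$ of the random vector $X = (X_1,\dotsc,X_p)^{\mathsf T}$.
   Context: $\|\cdot\|$ denotes the Euclidean ($\ell_2$) norm on $\mathbb{R}^p$. When $\lambda_{\min} = 0$, the quantity $1/\lambda_{\min}$ is interpreted as $+\infty$, so that the bound is vacuous in that case. *)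

theory Defs
  imports "HOL-Probability.Probability"
begin

definition eigenvalue :: "real^'n^'n \<Rightarrow> real \<Rightarrow> bool" where
  "eigenvalue A c \<longleftrightarrow> (\<exists>v. v \<noteq> 0 \<and> A *v v = c *\<^sub>R v)"

(* Only meaningful if the set of real eigenvalues is finite and nonempty,
   as is the case for symmetric A. *)
definition min_eigenvalue :: "real^'n^'n \<Rightarrow> real" where
  "min_eigenvalue A = Min {c. eigenvalue A c}"

definition second_moment_matrix :: "'a measure \<Rightarrow> ('n \<Rightarrow> 'a \<Rightarrow> real) \<Rightarrow> real^'n^'n" where
  "second_moment_matrix M X = (\<chi> i j. prob_space.expectation M (\<lambda>\<omega>. X i \<omega> * X j \<omega>))"

definition squared_loss ::
  "'a measure \<Rightarrow> ('n::finite \<Rightarrow> 'a \<Rightarrow> real) \<Rightarrow> ('a \<Rightarrow> real) \<Rightarrow> real^'n \<Rightarrow> real" where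
  "squared_loss M X y \<alpha> =
     prob_space.expectation M (\<lambda>\<omega>. ((\<Sum>i\<in>UNIV. \<alpha> $ i * X i \<omega>) - y \<omega>)\<^sup>2)"

(* A variance of 1 entails square integrability, since the Bochner integral of a
   non-integrable function is 0. *)
definition standardized :: "'a measure \<Rightarrow> ('a \<Rightarrow> real) \<Rightarrow> bool" where
  "standardized M Z \<longleftrightarrow>
     integrable M Z \<and> prob_space.expectation M Z = 0 \<and> prob_space.variance M Z = 1"

(* Reciprocals of eigenvalues are taken in ereal, where division by zero is infinite. *)
lemma one_divide_ereal_zero: "1 / ereal 0 = \<infinity>"
  by (simp add: divide_ereal_def)

end

theory Submission
  imports Defs
begin

text \<open>For a symmetric matrix \<open>A\<close> the minimum of \<open>v \<bullet> (A *v v)\<close> on the unit sphere is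
  an eigenvalue, so \<open>v \<bullet> (A *v v) \<ge> \<lambda> * (norm v)\<^sup>2\<close> for the least eigenvalue \<open>\<lambda>\<close>.
  Let \<open>A\<close> be the second-moment matrix and \<open>q = \<beta> \<bullet> (A *v \<beta>)\<close>, the second moment of
  the fitted value. The loss along the line \<open>t \<mapsto> t *\<^sub>R \<beta>\<close> is a quadratic in \<open>t\<close>,
  minimal at \<open>t = 1\<close>, which forces the loss at \<open>\<beta>\<close> to be \<open>1 - q\<close>. As the loss is
  nonnegative, \<open>\<lambda> * (norm \<beta>)\<^sup>2 \<le> q \<le> 1\<close>.\<close>

text \<open>Near \<open>t = 0\<close> the linear term dominates, so a nonzero \<open>b\<close> would
  give a negative value for one sign of \<open>t\<close>. This serves as the first-order condition
  at a minimum, both for the Rayleigh quotient and for the loss.\<close>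

lemma nonneg_quadratic_imp_linear_coeff_0:
  fixes b c :: real
  assumes "\<And>t. 2 * t * b + t\<^sup>2 * c \<ge> 0"
  shows "b = 0"
proof (rule ccontr)
  assume b: "b \<noteq> 0"
  \<comment> \<open>Any positive \<open>d\<close> with \<open>2 * d > c\<close> makes the quadratic
    negative at \<open>t = - b / d\<close>; this choice works for either sign of
    \<open>c\<close>.\<close>
  define d where "d = \<bar>c\<bar> + 1"
  have d: "d > 0" "c < 2 * d" by (auto simp: d_def)
  have "2 * (- b / d) * b + (- b / d)\<^sup>2 * c = (b / d)\<^sup>2 * (c - 2 * d)"
    using d by (simp add: field_simps power2_eq_square)
  also have "\<dots> < 0"
    using b d by (intro mult_pos_neg) auto
  finally show False
    using assms[of "- b / d"] by linarith
qed

lemma symmetric_matrix_inner: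
  fixes A :: "real^'n^'n"
  assumes "transpose A = A"
  shows "x \<bullet> (A *v y) = y \<bullet> (A *v x)"
  by (metis assms dot_lmul_matrix inner_commute transpose_matrix_vector)

text \<open>Eigenvectors for distinct eigenvalues are orthogonal, so choosing one per eigenvalue
  yields an independent set, which is finite in finite dimension. This makes the \<open>Min\<close>
  in \<open>min_eigenvalue\<close> meaningful.\<close>

lemma symmetric_finite_eigenvalues:
  fixes A :: "real^'n^'n"
  assumes A: "transpose A = A"
  shows "finite {c. eigenvalue A c}"
proof -
  define f where "f = (\<lambda>c. SOME v. v \<noteq> 0 \<and> A *v v = c *\<^sub>R v)"
  have f: "f c \<noteq> 0 \<and> A *v f c = c *\<^sub>R f c" if "eigenvalue A c" for c
    using that unfolding eigenvalue_def f_def by (rule someI_ex)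
  let ?E = "{c. eigenvalue A c}"
  have orth: "f c \<bullet> f d = 0" if "c \<in> ?E" "d \<in> ?E" "c \<noteq> d" for c d
  proof -
    have "d * (f c \<bullet> f d) = c * (f d \<bullet> f c)"
      using symmetric_matrix_inner[OF A, of "f c" "f d"] f that by simp
    then show ?thesis using that by (simp add: inner_commute)
  qed
  \<comment> \<open>A vector chosen for two distinct eigenvalues would be orthogonal to itself,
    hence zero.\<close>
  have inj: "inj_on f ?E"
    by (rule inj_onI) (metis orth f inner_eq_zero_iff mem_Collect_eq)
  have "pairwise orthogonal (f ` ?E)"
    unfolding pairwise_def orthogonal_def using orth by auto
  moreover have "0 \<notin> f ` ?E" using f by force
  ultimately have "finite (f ` ?E)"
    using pairwise_orthogonal_independent finiteI_independent by blast
  then show ?thesis using inj finite_imageD by blast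
qed

lemma symmetric_Rayleigh_eigenvalue:
  fixes A :: "real^'n^'n"
  assumes A: "transpose A = A"
  obtains m where "eigenvalue A m" "\<And>v. m * (norm v)\<^sup>2 \<le> v \<bullet> (A *v v)"
proof -
  have cont: "continuous_on (sphere 0 1) (\<lambda>v. v \<bullet> (A *v v))"
    by (intro continuous_intros)
  obtain u where u: "norm u = 1"
    and min: "\<And>v. norm v = 1 \<Longrightarrow> u \<bullet> (A *v u) \<le> v \<bullet> (A *v v)"
    using continuous_attains_inf[OF compact_sphere _ cont] by auto
  define m where "m = u \<bullet> (A *v u)"
  have ge: "m * (norm v)\<^sup>2 \<le> v \<bullet> (A *v v)" for v
  proof (cases "v = 0")
    case False
    have "m \<le> (v /\<^sub>R norm v) \<bullet> (A *v (v /\<^sub>R norm v))"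
      unfolding m_def using False by (intro min) simp
    also have "\<dots> = (v \<bullet> (A *v v)) / (norm v)\<^sup>2"
      by (simp add: matrix_vector_mult_scaleR power2_eq_square divide_inverse)
    finally show ?thesis using False by (simp add: pos_le_divide_eq)
  qed simp
  \<comment> \<open>The residual of the eigenvalue equation is also the direction in which
    \<open>u\<close> is perturbed. The inequality \<open>ge\<close> is tight at \<open>u\<close>,
    and along \<open>u + t *\<^sub>R r\<close> its gap is a quadratic in \<open>t\<close> with
    linear part \<open>2 * t * (r \<bullet> r)\<close>, so \<open>r\<close> must vanish.\<close>
  define r where "r = A *v u - m *\<^sub>R u"
  have "r \<bullet> r = 0"
  proof (rule nonneg_quadratic_imp_linear_coeff_0)
    fix t
    have uu: "u \<bullet> u = 1" using u by (simp add: dot_square_norm)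
    have norm: "(norm (u + t *\<^sub>R r))\<^sup>2 = 1 + 2 * t * (r \<bullet> u) + t\<^sup>2 * (r \<bullet> r)"
      unfolding power2_norm_eq_inner using uu
      by (simp add: inner_add_left inner_add_right inner_commute[of u r]
          algebra_simps power2_eq_square)
    have "(u + t *\<^sub>R r) \<bullet> (A *v (u + t *\<^sub>R r)) - m * (norm (u + t *\<^sub>R r))\<^sup>2
        = m + 2 * t * (r \<bullet> (A *v u)) + t\<^sup>2 * (r \<bullet> (A *v r))
          - m * (1 + 2 * t * (r \<bullet> u) + t\<^sup>2 * (r \<bullet> r))"
      unfolding norm using symmetric_matrix_inner[OF A, of u r]
      by (simp add: matrix_vector_right_distrib matrix_vector_mult_scaleR
          inner_add_left inner_add_right m_def[symmetric] algebra_simps power2_eq_square)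
    also have "\<dots> = 2 * t * (r \<bullet> r) + t\<^sup>2 * (r \<bullet> (A *v r) - m * (r \<bullet> r))"
    proof -
      have "r \<bullet> r = r \<bullet> (A *v u) - m * (r \<bullet> u)"
        by (subst (2) r_def) (simp add: inner_diff_right)
      then have "r \<bullet> (A *v u) = r \<bullet> r + m * (r \<bullet> u)" by simp
      then show ?thesis by (simp add: algebra_simps)
    qed
    finally show "0 \<le> 2 * t * (r \<bullet> r) + t\<^sup>2 * (r \<bullet> (A *v r) - m * (r \<bullet> r))"
      using ge[of "u + t *\<^sub>R r"] by linarith
  qed
  then have "eigenvalue A m"
    unfolding eigenvalue_def r_def using u by (intro exI[of _ u]) auto
  then show thesis using ge that by blast
qed

text \<open>The Rayleigh minimum \<open>m\<close> is itself an eigenvalue, so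
  \<open>min_eigenvalue A \<le> m\<close> and the lower bound with \<open>m\<close> carries
  over.\<close>

lemma symmetric_min_eigenvalue:
  fixes A :: "real^'n^'n"
  assumes A: "transpose A = A"
  shows eigenvalue_min_eigenvalue: "eigenvalue A (min_eigenvalue A)"
    and min_eigenvalue_le_quadratic_form: "min_eigenvalue A * (norm v)\<^sup>2 \<le> v \<bullet> (A *v v)"
proof -
  obtain m where m: "eigenvalue A m" "\<And>v. m * (norm v)\<^sup>2 \<le> v \<bullet> (A *v v)"
    using symmetric_Rayleigh_eigenvalue[OF A] by blast
  note fin = symmetric_finite_eigenvalues[OF A]
  show "eigenvalue A (min_eigenvalue A)"
    using Min_in[OF fin] m(1) unfolding min_eigenvalue_def by auto
  have "min_eigenvalue A \<le> m"
    using Min_le[OF fin] m(1) unfolding min_eigenvalue_def by auto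
  then have "min_eigenvalue A * (norm v)\<^sup>2 \<le> m * (norm v)\<^sup>2"
    by (intro mult_right_mono) auto
  then show "min_eigenvalue A * (norm v)\<^sup>2 \<le> v \<bullet> (A *v v)"
    using m(2)[of v] by linarith
qed

lemma standardized_second_moment:
  assumes "standardized M Z"
  shows standardized_integrable_square: "integrable M (\<lambda>\<omega>. (Z \<omega>)\<^sup>2)"
    and standardized_expectation_square: "prob_space.expectation M (\<lambda>\<omega>. (Z \<omega>)\<^sup>2) = 1"
proof -
  show *: "prob_space.expectation M (\<lambda>\<omega>. (Z \<omega>)\<^sup>2) = 1"
    using assms unfolding standardized_def by (metis (no_types, lifting) diff_zero
        Bochner_Integration.integral_cong)
  \<comment> \<open>Without integrability the expectation would take the default value 0 instead of
    1.\<close>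
  show "integrable M (\<lambda>\<omega>. (Z \<omega>)\<^sup>2)"
    using * not_integrable_integral_eq by fastforce
qed

lemma integrable_mult_of_squares:
  fixes f g :: "'a \<Rightarrow> real"
  assumes [measurable]: "f \<in> borel_measurable M" "g \<in> borel_measurable M"
    and "integrable M (\<lambda>\<omega>. (f \<omega>)\<^sup>2)" "integrable M (\<lambda>\<omega>. (g \<omega>)\<^sup>2)"
  shows "integrable M (\<lambda>\<omega>. f \<omega> * g \<omega>)"
proof (rule Bochner_Integration.integrable_bound)
  show "integrable M (\<lambda>\<omega>. (f \<omega>)\<^sup>2 + (g \<omega>)\<^sup>2)" using assms by simp
  have "\<bar>a * b\<bar> \<le> a\<^sup>2 + b\<^sup>2" for a b :: real
    using sum_squares_bound[of "\<bar>a\<bar>" "\<bar>b\<bar>"] abs_ge_zero[of "a * b"]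
    unfolding abs_mult power2_abs by linarith
  then show "AE \<omega> in M. norm (f \<omega> * g \<omega>) \<le> norm ((f \<omega>)\<^sup>2 + (g \<omega>)\<^sup>2)"
    by (intro AE_I2) simp
qed measurable

lemma transpose_second_moment_matrix:
  "transpose (second_moment_matrix M X) = second_moment_matrix M X"
  by (simp add: transpose_def second_moment_matrix_def mult.commute)

context
  fixes M :: "'a measure" and X :: "'p::finite \<Rightarrow> 'a \<Rightarrow> real"
  assumes int: "\<And>i j. integrable M (\<lambda>\<omega>. X i \<omega> * X j \<omega>)"
begin

lemma square_linear_combination:
  "(\<Sum>i\<in>UNIV. v $ i * X i \<omega>)\<^sup>2
    = (\<Sum>i\<in>UNIV. \<Sum>j\<in>UNIV. (v $ i * v $ j) * (X i \<omega> * X j \<omega>))"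
  by (simp add: power2_eq_square sum_product mult_ac)

lemma integrable_square_linear_combination:
  "integrable M (\<lambda>\<omega>. (\<Sum>i\<in>UNIV. v $ i * X i \<omega>)\<^sup>2)"
  unfolding square_linear_combination using int by simp

lemma second_moment_matrix_quadratic_form:
  "v \<bullet> (second_moment_matrix M X *v v)
    = prob_space.expectation M (\<lambda>\<omega>. (\<Sum>i\<in>UNIV. v $ i * X i \<omega>)\<^sup>2)"
  unfolding square_linear_combination using int
  by (simp add: inner_vec_def matrix_vector_mult_def second_moment_matrix_def
      sum_distrib_left mult_ac)

text \<open>At an eigenvector the quadratic form is the eigenvalue times a positive number, and it
  is also the expectation of a square. The sign permits dividing by the eigenvalue once it is
  nonzero.\<close>

lemma min_eigenvalue_second_moment_matrix_nonneg:
  "min_eigenvalue (second_moment_matrix M X) \<ge> 0"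
proof -
  let ?A = "second_moment_matrix M X"
  obtain v where v: "v \<noteq> 0" "?A *v v = min_eigenvalue ?A *\<^sub>R v"
    using eigenvalue_min_eigenvalue[OF transpose_second_moment_matrix[of M X]]
    unfolding eigenvalue_def by blast
  have "0 \<le> v \<bullet> (?A *v v)"
    by (simp add: second_moment_matrix_quadratic_form)
  also have "\<dots> = min_eigenvalue ?A * (norm v)\<^sup>2"
    using v(2) by (simp add: power2_norm_eq_inner)
  finally have "0 \<le> min_eigenvalue ?A * (norm v)\<^sup>2" .
  then show ?thesis
    using v(1) by (simp add: zero_le_mult_iff)
qed

end

lemma least_squares_fit_second_moment_le_1:
  fixes X :: "'p::finite \<Rightarrow> 'a \<Rightarrow> real"
  assumes [measurable]: "\<And>i. X i \<in> borel_measurable M" "y \<in> borel_measurable M"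
    and int: "\<And>i j. integrable M (\<lambda>\<omega>. X i \<omega> * X j \<omega>)"
    and y: "standardized M y"
    and min: "\<And>\<alpha>. squared_loss M X y \<beta> \<le> squared_loss M X y \<alpha>"
  shows "prob_space.expectation M (\<lambda>\<omega>. (\<Sum>i\<in>UNIV. \<beta> $ i * X i \<omega>)\<^sup>2) \<le> 1"
proof -
  define F where "F = (\<lambda>\<omega>. \<Sum>i\<in>UNIV. \<beta> $ i * X i \<omega>)"
  have [measurable]: "F \<in> borel_measurable M" unfolding F_def by measurable
  have F2: "integrable M (\<lambda>\<omega>. (F \<omega>)\<^sup>2)"
    unfolding F_def using integrable_square_linear_combination[of M X, OF int] .
  note y2 = standardized_integrable_square[OF y]
  have Fy: "integrable M (\<lambda>\<omega>. F \<omega> * y \<omega>)"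
    by (rule integrable_mult_of_squares[OF _ _ F2 y2]) measurable
  define q where "q = prob_space.expectation M (\<lambda>\<omega>. (F \<omega>)\<^sup>2)"
  define b where "b = prob_space.expectation M (\<lambda>\<omega>. F \<omega> * y \<omega>)"
  have loss: "squared_loss M X y (t *\<^sub>R \<beta>) = t\<^sup>2 * q - 2 * t * b + 1" for t
  proof -
    have scaled: "(\<Sum>i\<in>UNIV. (t *\<^sub>R \<beta>) $ i * X i \<omega>) = t * F \<omega>" for \<omega>
      by (simp add: F_def sum_distrib_left mult_ac)
    have "squared_loss M X y (t *\<^sub>R \<beta>)
        = prob_space.expectation M (\<lambda>\<omega>. t\<^sup>2 * (F \<omega>)\<^sup>2 - 2 * t * (F \<omega> * y \<omega>) + (y \<omega>)\<^sup>2)"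
      unfolding squared_loss_def scaled by (simp add: power2_diff power_mult_distrib algebra_simps)
    then show ?thesis
      using F2 Fy y2 by (simp add: q_def b_def standardized_expectation_square[OF y])
  qed
  \<comment> \<open>This is the normal equation in the direction \<open>\<beta>\<close>: the
    residual is orthogonal to the fit \<open>F\<close>. Shifting the parameter to
    \<open>1 + t\<close> moves the minimum to \<open>t = 0\<close>.\<close>
  have "q - b = 0"
  proof (rule nonneg_quadratic_imp_linear_coeff_0)
    fix t
    have "squared_loss M X y (1 *\<^sub>R \<beta>) \<le> squared_loss M X y ((1 + t) *\<^sub>R \<beta>)"
      using min by simp
    then show "0 \<le> 2 * t * (q - b) + t\<^sup>2 * q"
      unfolding loss by (simp add: algebra_simps power2_eq_square)
  qed
  \<comment> \<open>With \<open>b = q\<close> this loss equals \<open>1 - q\<close>.\<close>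
  moreover have "0 \<le> squared_loss M X y (1 *\<^sub>R \<beta>)"
    unfolding squared_loss_def by simp
  ultimately show ?thesis
    unfolding loss q_def[symmetric, unfolded F_def] by simp
qed

theorem theorem5:
  fixes M :: "'a measure"
    and X :: "'p::finite \<Rightarrow> 'a \<Rightarrow> real"
    and y :: "'a \<Rightarrow> real"
    and \<beta> :: "real^'p"
  assumes "prob_space M"
    and "\<And>i. X i \<in> borel_measurable M"
    and "y \<in> borel_measurable M"
    and "\<And>i. standardized M (X i)"
    and "standardized M y"
    and "is_arg_min (squared_loss M X y) (\<lambda>\<alpha>. \<alpha> \<in> UNIV) \<beta>"
  shows "ereal ((norm \<beta>)\<^sup>2) \<le> 1 / ereal (min_eigenvalue (second_moment_matrix M X))"
proof -
  let ?l = "min_eigenvalue (second_moment_matrix M X)"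
  have int: "integrable M (\<lambda>\<omega>. X i \<omega> * X j \<omega>)" for i j
    using assms(2,4) by (intro integrable_mult_of_squares standardized_integrable_square)
  have "?l * (norm \<beta>)\<^sup>2 \<le> \<beta> \<bullet> (second_moment_matrix M X *v \<beta>)"
    by (rule min_eigenvalue_le_quadratic_form[OF transpose_second_moment_matrix])
  also have "\<dots> \<le> 1"
    unfolding second_moment_matrix_quadratic_form[of M X, OF int]
    using assms int
    by (intro least_squares_fit_second_moment_le_1) (auto simp: is_arg_min_linorder)
  finally have bound: "?l * (norm \<beta>)\<^sup>2 \<le> 1" .
  show ?thesis
  \<comment> \<open>If the eigenvalue is zero, the right-hand side is infinite; otherwise it is
    positive and \<open>bound\<close> can be divided by it.\<close>
  proof (cases "?l = 0")
    case True
    then show ?thesis by (simp only: one_divide_ereal_zero) simp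
  next
    case False
    then have "?l > 0"
      using min_eigenvalue_second_moment_matrix_nonneg[of M X, OF int] by linarith
    then show ?thesis
      using bound by (simp add: one_ereal_def field_simps)
  qed
qed

end
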